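(* Fix $\lambda_S>0$, $\lambda_{PT}>0$, $R_p>0$, $R_I>0$. Let $p_{tx}$ be the transmission power of the secondary users, and let $\mu$ be the conditional average degree of a secondary user. Under the disk signal propagation and interference model, in which $r_I=c\,(p_{tx})^{1/\alpha}$ for a constant $c>0$ and $r_p=\beta r_I$ for a constant $\beta\in(0,1)$, $$\mu=O\left((p_{tx})^{-2/\alpha}\right)\quad\text{as }p_{tx}\to\infty,$$ where $\alpha>0$ is the path-loss exponent.
   Context: Heterogeneous network model in $\mathbb{R}^2$ with parameters $R_p,R_I,r_p,r_I>0$. Primary transmitters form a homogeneous Poisson point process of density $\lambda_{PT}$; each primary transmitter has one primary receiver, located uniformly at random in the disk of radius $R_p$ centered at the transmitter, independently for different transmitters. Secondary users form a homogeneous Poisson point process of density $\lambda_S$, independent of the primary transmitters and receivers. A secondary user sees an opportunity if there is no primary transmitter within distance $R_I$ of it and no primary receiver within distance $r_I$ of it. Two distinct secondary users are linked if and only if their distance is at most $r_p$ and both see an opportunity. Conditional average degree: for a typical secondary user $A$ (equivalently, a secondary user added at the origin to the Poisson process of secondary users), $\mu=\mathbb{E}[\deg(A)\mid A\text{ sees an opportunity}]$, where $\deg(A)$ is the number of secondary users linked to $A$, i.e. (when $A$ sees an opportunity) the number of other secondary users within distance $r_p$ of $A$ that see an opportunity. $f(x)=O(g(x))$ as $x\to\infty$ means there exist $M>0,x_0>0$ with $|f(x)|\le M|g(x)|$ for all $x>x_0$. *)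

theory Defs
  imports "HOL-Probability.Probability"
begin

text \<open>
  A point process is a random locally finite set, given by its integer-valued counts on bounded
  Borel sets. Local finiteness holds for every outcome, so \<^term>\<open>card\<close> is a true count.
\<close>

definition point_process :: "'w measure \<Rightarrow> ('w \<Rightarrow> 'a::euclidean_space set) \<Rightarrow> bool" where
  "point_process M N \<longleftrightarrow>
     (\<forall>A. A \<in> sets borel \<and> bounded A \<longrightarrow>
        (\<forall>w\<in>space M. finite (N w \<inter> A)) \<and>
        (\<lambda>w. card (N w \<inter> A)) \<in> measurable M (count_space UNIV))"

definition process_events :: "'w measure \<Rightarrow> ('w \<Rightarrow> 'a::euclidean_space set) \<Rightarrow> 'w set set" where
  "process_events M N =
     sigma_sets (space M)
       {{w \<in> space M. card (N w \<inter> A) = k} | A k. A \<in> sets borel \<and> bounded A}"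

text \<open>
  The Poisson law is spelled out because \<^const>\<open>poisson_pmf\<close> requires a positive rate, while
  Lebesgue-null sets \<open>A\<close> have rate \<open>0\<close>.
\<close>

definition homogeneous_poisson_process ::
  "'w measure \<Rightarrow> real \<Rightarrow> ('w \<Rightarrow> 'a::euclidean_space set) \<Rightarrow> bool" where
  "homogeneous_poisson_process M l N \<longleftrightarrow>
     point_process M N \<and>
     (\<forall>A k. A \<in> sets borel \<and> bounded A \<longrightarrow>
        measure M {w \<in> space M. card (N w \<inter> A) = k} =
          exp (- (l * measure lborel A)) * (l * measure lborel A) ^ k / fact k) \<and>
     (\<forall>(I :: nat set) A. finite I \<and> disjoint_family_on A I \<and>
        (\<forall>i\<in>I. A i \<in> sets borel \<and> bounded (A i)) \<longrightarrow>
        prob_space.indep_vars M (\<lambda>_. count_space UNIV) (\<lambda>i w. card (N w \<inter> A i)) I)"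

definition sees_opportunity ::
  "'a::metric_space set \<Rightarrow> 'a set \<Rightarrow> real \<Rightarrow> real \<Rightarrow> 'a \<Rightarrow> bool" where
  "sees_opportunity T Z RI rI x \<longleftrightarrow>
     \<not> (\<exists>t\<in>T. dist x t \<le> RI) \<and> \<not> (\<exists>z\<in>Z. dist x z \<le> rI)"

definition linked ::
  "'a::metric_space set \<Rightarrow> 'a set \<Rightarrow> real \<Rightarrow> real \<Rightarrow> real \<Rightarrow> 'a \<Rightarrow> 'a \<Rightarrow> bool" where
  "linked T Z RI rI rp x y \<longleftrightarrow>
     x \<noteq> y \<and> dist x y \<le> rp \<and>
     sees_opportunity T Z RI rI x \<and> sees_opportunity T Z RI rI y"

definition degree_in ::
  "'a::metric_space set \<Rightarrow> 'a set \<Rightarrow> 'a set \<Rightarrow> real \<Rightarrow> real \<Rightarrow> real \<Rightarrow> 'a \<Rightarrow> nat" where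
  "degree_in T Z U RI rI rp x = card {y \<in> U. linked T Z RI rI rp x y}"

definition transmitters :: "(nat \<Rightarrow> 'w \<Rightarrow> 'a) \<Rightarrow> 'w \<Rightarrow> 'a set" where
  "transmitters X w = range (\<lambda>i. X i w)"

definition receivers :: "(nat \<Rightarrow> 'w \<Rightarrow> 'a::plus) \<Rightarrow> (nat \<Rightarrow> 'w \<Rightarrow> 'a) \<Rightarrow> 'w \<Rightarrow> 'a set" where
  "receivers X D w = range (\<lambda>i. X i w + D i w)"

text \<open>
  \<open>X i\<close> enumerates the primary transmitters (infinitely many almost surely, as \<open>l\<^sub>T > 0\<close>),
  \<open>X i + D i\<close> is the receiver of \<open>X i\<close>, and \<open>S\<close> is the set of secondary users.
\<close>

locale heterogeneous_network = prob_space M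
  for M :: "'w measure"
    and l\<^sub>T l\<^sub>S R\<^sub>p :: real
    and X D :: "nat \<Rightarrow> 'w \<Rightarrow> real ^ 2"
    and S :: "'w \<Rightarrow> (real ^ 2) set" +
  assumes transmitter_measurable: "\<And>i. X i \<in> borel_measurable M"
    and transmitter_inj: "\<And>w. w \<in> space M \<Longrightarrow> inj (\<lambda>i. X i w)"
    and transmitters_poisson: "homogeneous_poisson_process M l\<^sub>T (transmitters X)"
    and displacement_indep: "indep_vars (\<lambda>_. borel) D UNIV"
    and displacement_uniform: "\<And>i. distr M borel (D i) = uniform_measure lborel (cball 0 R\<^sub>p)"
    and displacement_indep_transmitters:
      "indep_var (Pi\<^sub>M UNIV (\<lambda>_. borel)) (\<lambda>w i. X i w) (Pi\<^sub>M UNIV (\<lambda>_. borel)) (\<lambda>w i. D i w)"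
    and secondary_poisson: "homogeneous_poisson_process M l\<^sub>S S"
    and secondary_indep_primary:
      "indep_set (process_events M S)
         (sets (vimage_algebra (space M) (\<lambda>w. (\<lambda>i. X i w, \<lambda>i. D i w))
            (Pi\<^sub>M UNIV (\<lambda>_. borel) \<Otimes>\<^sub>M Pi\<^sub>M UNIV (\<lambda>_. borel))))"

text \<open>
  The typical secondary user is an extra user at the origin. The mean is a \<open>[0, \<infinity>]\<close>-valued
  integral against the conditional probability measure, so no integrability convention enters.
\<close>

definition conditional_mean_degree ::
  "'w measure \<Rightarrow> (nat \<Rightarrow> 'w \<Rightarrow> real ^ 2) \<Rightarrow> (nat \<Rightarrow> 'w \<Rightarrow> real ^ 2) \<Rightarrow> ('w \<Rightarrow> (real ^ 2) set) \<Rightarrow>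
    real \<Rightarrow> real \<Rightarrow> real \<Rightarrow> ennreal" where
  "conditional_mean_degree M X D S RI rI rp =
     (\<integral>\<^sup>+ w. of_nat (degree_in (transmitters X w) (receivers X D w) (insert 0 (S w)) RI rI rp 0)
        \<partial>uniform_measure M
           {w \<in> space M. sees_opportunity (transmitters X w) (receivers X D w) RI rI 0})"

end

theory Submission
  imports Defs
begin

text \<open>
  Let \<open>r\<close> be the interference radius \<open>r\<^sub>I\<close>. Once \<open>r \<ge> R\<^sub>I + R\<^sub>p\<close>, the void probabilities of the
  marked process of transmitter-receiver pairs show that a user at \<open>y\<close> sees an opportunity, given
  that the origin does, with probability at most \<open>exp (- l\<^sub>T * a)\<close>, where \<open>a\<close> is the area of
  \<open>cball y r - cball 0 r\<close>. This area is of order \<open>r * norm y\<close>, so the mean degree is at most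
  a constant times the integral of \<open>exp (- b * r * norm y)\<close> over the plane, which is of order
  \<open>r powr - 2\<close>, that is \<open>p powr (- 2 / \<alpha>)\<close>.
\<close>

subsection \<open>Counts and generating functional of a Poisson process\<close>

text \<open>The neighbours of the origin are random points, so a probability computed for a fixed
  \<open>y\<close> cannot be inserted directly. The degree is instead dominated by a finite sum of
  terms, each a count of secondary users in a fixed set times the indicator of an event of the
  primary network. Independence of \<open>S\<close> from that network then evaluates every mean,
  without a Campbell or Palm formula. The condition \<open>R\<^sub>I + R\<^sub>p \<le> r\<close>
  makes exponents add: a transmitter within \<open>R\<^sub>I\<close> of the origin keeps its
  receiver inside \<open>cball 0 r\<close>, so the pairs that put a receiver into the uncovered part
  of a second disk are disjoint from the pairs that block the origin. Conditioning thus amounts to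
  cancelling a common factor. The linear growth of the area comes from subadditivity under
  translations, which replaces an explicit formula for the lens of two disks. On a lattice of mesh
  \<open>1 / r\<close> the exponent \<open>r * norm y\<close> becomes the norm of an integer point.
  The lattice sum is therefore bounded uniformly in \<open>r\<close>, and the factor
  \<open>r powr - 2\<close> is the area of one cell.\<close>

lemma nn_integral_nat_valued_indicator:
  assumes K: "K \<in> measurable M (count_space UNIV)" and E: "E \<in> sets M"
  shows "(\<integral>\<^sup>+ w. f (K w :: nat) * indicator E w \<partial>M) = (\<Sum>k. f k * emeasure M ({w \<in> space M. K w = k} \<inter> E))"
proof -
  have m [measurable]: "{w \<in> space M. K w = k} \<in> sets M" for k
    using measurable_sets[OF K, of "{k}"] by (simp add: vimage_def Int_def conj_commute)
  have [measurable]: "E \<in> sets M" by fact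
  have "f (K w) * indicator E w = (\<Sum>k. f k * indicator ({w \<in> space M. K w = k} \<inter> E) w)"
    if "w \<in> space M" for w
  proof -
    have "(\<Sum>k. f k * indicator ({w \<in> space M. K w = k} \<inter> E) w) =
        (\<Sum>k\<in>{K w}. f k * indicator ({w \<in> space M. K w = k} \<inter> E) w :: ennreal)"
      by (rule suminf_finite) auto
    then show ?thesis using that by (simp add: indicator_def)
  qed
  then have "(\<integral>\<^sup>+ w. f (K w) * indicator E w \<partial>M) =
      (\<integral>\<^sup>+ w. (\<Sum>k. f k * indicator ({w \<in> space M. K w = k} \<inter> E) w) \<partial>M)"
    by (intro nn_integral_cong) auto
  also have "\<dots> = (\<Sum>k. \<integral>\<^sup>+ w. f k * indicator ({w \<in> space M. K w = k} \<inter> E) w \<partial>M)"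
    by (rule nn_integral_suminf) measurable
  also have "\<dots> = (\<Sum>k. f k * emeasure M ({w \<in> space M. K w = k} \<inter> E))"
    by (intro suminf_cong nn_integral_cmult_indicator) measurable
  finally show ?thesis .
qed

lemma poisson_pgf_sums:
  fixes m t :: real
  shows "(\<lambda>k. t ^ k * (exp (- m) * m ^ k / fact k)) sums exp (- (m * (1 - t)))"
proof -
  have "(\<lambda>k. exp (- m) * ((t * m) ^ k /\<^sub>R fact k)) sums (exp (- m) * exp (t * m))"
    by (intro sums_mult exp_converges)
  then show ?thesis
    by (simp add: power_mult_distrib field_simps flip: exp_add)
qed

lemma poisson_mean_sums:
  fixes m :: real
  shows "(\<lambda>k. real k * (exp (- m) * m ^ k / fact k)) sums m"
proof -
  have "(\<lambda>k. m * exp (- m) * (m ^ k /\<^sub>R fact k)) sums (m * exp (- m) * exp m)"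
    by (intro sums_mult exp_converges)
  then have "(\<lambda>k. real (Suc k) * (exp (- m) * m ^ Suc k / fact (Suc k))) sums m"
    by (simp add: field_simps exp_minus del: of_nat_Suc)
  then show ?thesis
    by (subst (asm) sums_Suc_iff) simp
qed

lemma nn_integral_poisson_pgf:
  fixes N :: "'w \<Rightarrow> 'a::euclidean_space set"
  assumes M: "prob_space M" and N: "homogeneous_poisson_process M l N"
    and A: "A \<in> sets borel" "bounded A" and t: "0 \<le> t"
  shows "(\<integral>\<^sup>+ w. ennreal (t ^ card (N w \<inter> A)) \<partial>M) = ennreal (exp (- (l * measure lborel A * (1 - t))))"
proof -
  interpret prob_space M by fact
  have K: "(\<lambda>w. card (N w \<inter> A)) \<in> measurable M (count_space UNIV)"
    using N A by (auto simp: homogeneous_poisson_process_def point_process_def)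
  have p: "measure M {w \<in> space M. card (N w \<inter> A) = k} =
      exp (- (l * measure lborel A)) * (l * measure lborel A) ^ k / fact k" for k
    using N A by (auto simp: homogeneous_poisson_process_def)
  have "(\<integral>\<^sup>+ w. ennreal (t ^ card (N w \<inter> A)) * indicator (space M) w \<partial>M) =
      (\<Sum>k. ennreal (t ^ k) * emeasure M ({w \<in> space M. card (N w \<inter> A) = k} \<inter> space M))"
    using nn_integral_nat_valued_indicator[OF K sets.top, of "\<lambda>k. ennreal (t ^ k)"] by simp
  also have "\<dots> = (\<Sum>k. ennreal (t ^ k * measure M {w \<in> space M. card (N w \<inter> A) = k}))"
    using t by (simp add: emeasure_eq_measure ennreal_mult Int_absorb2 subset_eq)
  \<comment> \<open>Folded back into probabilities, the Poisson weights are visibly nonnegative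
    although \<open>l\<close> carries no sign assumption.\<close>
  also have "\<dots> = ennreal (exp (- (l * measure lborel A * (1 - t))))"
    using poisson_pgf_sums[of t "l * measure lborel A"] t unfolding p[symmetric]
    by (intro suminf_ennreal_eq) auto
  finally show ?thesis
    by (simp cong: nn_integral_cong)
qed

text \<open>\<open>E\<close> will be an event of the primary network. Splitting by the value of the
  count needs independence only for the generators of \<open>process_events\<close>.\<close>

lemma nn_integral_poisson_count_indep:
  fixes N :: "'w \<Rightarrow> 'a::euclidean_space set"
  assumes M: "prob_space M" and N: "homogeneous_poisson_process M l N"
    and A: "A \<in> sets borel" "bounded A"
    and F: "prob_space.indep_set M (process_events M N) F" "E \<in> F"
  shows "(\<integral>\<^sup>+ w. of_nat (card (N w \<inter> A)) * indicator E w \<partial>M) =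
      ennreal (l * measure lborel A * measure M E)"
proof -
  interpret prob_space M by fact
  have K: "(\<lambda>w. card (N w \<inter> A)) \<in> measurable M (count_space UNIV)"
    using N A by (auto simp: homogeneous_poisson_process_def point_process_def)
  have p: "measure M {w \<in> space M. card (N w \<inter> A) = k} =
      exp (- (l * measure lborel A)) * (l * measure lborel A) ^ k / fact k" for k
    using N A by (auto simp: homogeneous_poisson_process_def)
  have E: "E \<in> sets M" using F by (auto simp: indep_set_def indep_sets_def split: bool.splits)
  have "{w \<in> space M. card (N w \<inter> A) = k} \<in> process_events M N" for k
    unfolding process_events_def using A by (intro sigma_sets.Basic) blast
  then have ind: "prob ({w \<in> space M. card (N w \<inter> A) = k} \<inter> E) =
      prob {w \<in> space M. card (N w \<inter> A) = k} * prob E" for k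
    using F indep_setD by blast
  have "(\<integral>\<^sup>+ w. of_nat (card (N w \<inter> A)) * indicator E w \<partial>M) =
      (\<Sum>k. of_nat k * emeasure M ({w \<in> space M. card (N w \<inter> A) = k} \<inter> E))"
    using nn_integral_nat_valued_indicator[OF K E, of of_nat] by simp
  also have "\<dots> = (\<Sum>k. ennreal (real k * prob {w \<in> space M. card (N w \<inter> A) = k} * prob E))"
    by (simp add: emeasure_eq_measure ind ennreal_mult mult.assoc ennreal_of_nat_eq_real_of_nat)
  also have "\<dots> = ennreal (l * measure lborel A * measure M E)"
    using sums_mult2[OF poisson_mean_sums[of "l * measure lborel A"], of "prob E"] unfolding p[symmetric]
    by (intro suminf_ennreal_eq) auto
  finally show ?thesis .
qed

text \<open>The level sets of \<open>\<kappa>\<close> cut \<open>B\<close> into finitely many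
  disjoint bounded pieces. Their counts are independent Poisson variables, so the mean of the
  product factors into the generating functions of the single counts.\<close>

lemma poisson_generating_functional_discrete:
  fixes N :: "'w \<Rightarrow> 'a::euclidean_space set" and t :: "nat \<Rightarrow> real"
  assumes M: "prob_space M" and N: "homogeneous_poisson_process M l N"
    and B: "B \<in> sets borel" "bounded B"
    and \<kappa>: "\<kappa> \<in> measurable borel (count_space UNIV)" "\<And>x. \<kappa> x \<le> n"
    and t: "\<And>k. 0 \<le> t k" "\<And>k. t k \<le> 1"
  shows "(\<lambda>w. \<Prod>x\<in>N w \<inter> B. t (\<kappa> x)) \<in> borel_measurable M" (is ?meas)
    and "(\<integral>w. (\<Prod>x\<in>N w \<inter> B. t (\<kappa> x)) \<partial>M) = exp (- (l * (\<integral>x. indicator B x * (1 - t (\<kappa> x)) \<partial>lborel)))" (is ?int)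
proof -
  interpret prob_space M by fact
  define A where "A k = B \<inter> \<kappa> -` {k}" for k
  have A: "A k \<in> sets borel" "bounded (A k)" for k
    using B measurable_sets[OF \<kappa>(1), of "{k}"] by (auto simp: A_def intro: bounded_subset)
  have int_A: "integrable lborel (indicator (A k) :: 'a \<Rightarrow> real)" for k
    using A emeasure_bounded_finite by (intro integrable_real_indicator) auto
  have disj: "disjoint_family_on A {..n}"
    by (auto simp: disjoint_family_on_def A_def)
  have K [measurable]: "(\<lambda>w. card (N w \<inter> A k)) \<in> measurable M (count_space UNIV)" for k
    using N A by (auto simp: homogeneous_poisson_process_def point_process_def)
  have fin: "finite (N w \<inter> B)" if "w \<in> space M" for w
    using N B that by (auto simp: homogeneous_poisson_process_def point_process_def)
  have eq: "(\<Prod>x\<in>N w \<inter> B. t (\<kappa> x)) = (\<Prod>k\<le>n. t k ^ card (N w \<inter> A k))" if "w \<in> space M" for w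
  proof -
    have "(\<Prod>x\<in>N w \<inter> B. t (\<kappa> x)) = (\<Prod>k\<le>n. \<Prod>x | x \<in> N w \<inter> B \<and> \<kappa> x = k. t (\<kappa> x))"
      using fin[OF that] \<kappa>(2) by (subst prod.group) auto
    also have "\<dots> = (\<Prod>k\<le>n. \<Prod>x\<in>N w \<inter> A k. t k)"
      by (intro prod.cong) (auto simp: A_def)
    finally show ?thesis by simp
  qed
  have meas: "(\<lambda>w. t k ^ card (N w \<inter> A k)) \<in> borel_measurable M" for k
    by measurable
  show ?meas
    by (subst measurable_cong[OF eq]) (use meas in measurable)
  have indep: "indep_vars (\<lambda>_. borel) (\<lambda>k w. t k ^ card (N w \<inter> A k)) {..n}"
  proof -
    have "indep_vars (\<lambda>_. count_space UNIV) (\<lambda>k w. card (N w \<inter> A k)) {..n}"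
      using N disj A by (auto simp: homogeneous_poisson_process_def)
    then show ?thesis
      by (rule indep_vars_compose2) auto
  qed
  have intb: "integrable M (\<lambda>w. t k ^ card (N w \<inter> A k))" for k
    using meas t by (intro integrable_const_bound[where B=1]) (auto simp: power_le_one)
  have one: "(\<integral>w. t k ^ card (N w \<inter> A k) \<partial>M) = exp (- (l * measure lborel (A k) * (1 - t k)))" for k
    using nn_integral_poisson_pgf[OF M N A t(1)] meas t
    by (subst integral_eq_nn_integral) auto
  have "(\<integral>w. (\<Prod>x\<in>N w \<inter> B. t (\<kappa> x)) \<partial>M) = (\<integral>w. (\<Prod>k\<le>n. t k ^ card (N w \<inter> A k)) \<partial>M)"
    using eq by (intro Bochner_Integration.integral_cong) auto
  also have "\<dots> = (\<Prod>k\<le>n. exp (- (l * measure lborel (A k) * (1 - t k))))"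
    by (subst indep_vars_lebesgue_integral[OF _ indep intb]) (auto simp: one)
  also have "\<dots> = exp (- (l * (\<Sum>k\<le>n. measure lborel (A k) * (1 - t k))))"
    by (simp add: exp_sum sum_negf sum_distrib_left mult.assoc flip: exp_sum)
  also have "(\<Sum>k\<le>n. measure lborel (A k) * (1 - t k)) = (\<integral>x. (\<Sum>k\<le>n. indicator (A k) x * (1 - t k)) \<partial>lborel)"
    using int_A by (subst Bochner_Integration.integral_sum) auto
  also have "(\<lambda>x. \<Sum>k\<le>n. indicator (A k) x * (1 - t k)) = (\<lambda>x. indicator B x * (1 - t (\<kappa> x)))"
  proof
    fix x
    have "(\<Sum>k\<le>n. indicator (A k) x * (1 - t k)) = (\<Sum>k\<le>n. if k = \<kappa> x then indicator B x * (1 - t k) else 0)"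
      by (intro sum.cong) (auto simp: A_def indicator_def)
    then show "(\<Sum>k\<le>n. indicator (A k) x * (1 - t k)) = indicator B x * (1 - t (\<kappa> x))"
      using \<kappa>(2) by simp
  qed
  finally show ?int .
qed

text \<open>The error is at most one grid step; \<open>nat\<close> clips negative values, whence
  \<open>max 0 y\<close>.\<close>

lemma floor_approx_tendsto:
  fixes y :: real
  shows "(\<lambda>n. real (nat \<lfloor>real (Suc n) * y\<rfloor>) / real (Suc n)) \<longlonglongrightarrow> max 0 y"
proof (rule Lim_null_comparison[where g="\<lambda>n. 1 / real (Suc n)", THEN Lim_null[THEN iffD2]])
  have "\<bar>real (nat \<lfloor>real (Suc n) * y\<rfloor>) / real (Suc n) - max 0 y\<bar> \<le> 1 / real (Suc n)" for n
  proof (cases "y \<ge> 0")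
    case True
    then have "0 \<le> real (Suc n) * y" by simp
    then have "\<bar>real (nat \<lfloor>real (Suc n) * y\<rfloor>) - real (Suc n) * y\<bar> \<le> 1"
      using floor_correct[of "real (Suc n) * y"] by linarith
    then have "\<bar>real (nat \<lfloor>real (Suc n) * y\<rfloor>) - real (Suc n) * y\<bar> / real (Suc n) \<le> 1 / real (Suc n)"
      by (intro divide_right_mono) auto
    also have "\<bar>real (nat \<lfloor>real (Suc n) * y\<rfloor>) - real (Suc n) * y\<bar> / real (Suc n) =
        \<bar>(real (nat \<lfloor>real (Suc n) * y\<rfloor>) - real (Suc n) * y) / real (Suc n)\<bar>"
      by simp
    also have "(real (nat \<lfloor>real (Suc n) * y\<rfloor>) - real (Suc n) * y) / real (Suc n) =
        real (nat \<lfloor>real (Suc n) * y\<rfloor>) / real (Suc n) - y"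
      by (simp add: diff_divide_distrib del: of_nat_Suc)
    finally show ?thesis using True by simp
  next
    case False
    then have "real (Suc n) * y \<le> 0" by (simp add: mult_nonneg_nonpos)
    then have "nat \<lfloor>real (Suc n) * y\<rfloor> = 0" by linarith
    then show ?thesis using False by simp
  qed
  then show "\<forall>\<^sub>F n in sequentially. norm (real (nat \<lfloor>real (Suc n) * y\<rfloor>) / real (Suc n) - max 0 y) \<le> 1 / real (Suc n)"
    by simp
  show "(\<lambda>n. 1 / real (Suc n)) \<longlonglongrightarrow> 0"
    using LIMSEQ_inverse_real_of_nat by (simp add: inverse_eq_divide)
qed

text \<open>Rounding \<open>h\<close> down to multiples of \<open>1 / Suc n\<close> reduces to
  finitely many values. Dominated convergence then applies on both sides, with bound 1 under
  \<open>M\<close> and bound \<open>indicator B\<close> under \<open>lborel\<close>.\<close>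

lemma poisson_generating_functional:
  fixes N :: "'w \<Rightarrow> 'a::euclidean_space set" and h :: "'a \<Rightarrow> real"
  assumes M: "prob_space M" and N: "homogeneous_poisson_process M l N"
    and B: "B \<in> sets borel" "bounded B"
    and h: "h \<in> borel_measurable borel" "\<And>x. 0 \<le> h x" "\<And>x. h x \<le> 1"
  shows "(\<lambda>w. \<Prod>x\<in>N w \<inter> B. h x) \<in> borel_measurable M" (is ?meas)
    and "(\<integral>w. (\<Prod>x\<in>N w \<inter> B. h x) \<partial>M) = exp (- (l * (\<integral>x. indicator B x * (1 - h x) \<partial>lborel)))" (is ?int)
proof -
  interpret prob_space M by fact
  note [measurable] = h(1) B(1)
  define \<kappa> where "\<kappa> n x = nat \<lfloor>real (Suc n) * h x\<rfloor>" for n x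
  \<comment> \<open>The discrete version asks for weights at most 1 at every index; the cap is
    inactive at the values that \<open>\<kappa> n\<close> takes.\<close>
  define t where "t n k = min 1 (real k / real (Suc n))" for n k
  have \<kappa>_meas [measurable]: "\<kappa> n \<in> measurable borel (count_space UNIV)" for n
    unfolding \<kappa>_def by measurable
  have \<kappa>_le: "\<kappa> n x \<le> Suc n" for n x
  proof -
    have "real (Suc n) * h x \<le> real (Suc n)" using h by (intro mult_left_le) auto
    then show ?thesis unfolding \<kappa>_def by linarith
  qed
  have t: "0 \<le> t n k" "t n k \<le> 1" for n k by (auto simp: t_def)
  have lim: "(\<lambda>n. t n (\<kappa> n x)) \<longlonglongrightarrow> h x" for x
  proof -
    have "t n (\<kappa> n x) = real (\<kappa> n x) / real (Suc n)" for n
      using \<kappa>_le[of n x] by (simp add: t_def min_def del: of_nat_Suc)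
    then show ?thesis using floor_approx_tendsto[of "h x"] h(2)[of x] by (simp add: \<kappa>_def del: of_nat_Suc)
  qed
  note discr = poisson_generating_functional_discrete[OF M N B \<kappa>_meas \<kappa>_le, where t="t n" for n, OF t]
  have lim_prod: "(\<lambda>n. \<Prod>x\<in>N w \<inter> B. t n (\<kappa> n x)) \<longlonglongrightarrow> (\<Prod>x\<in>N w \<inter> B. h x)" for w
    by (intro tendsto_prod lim)
  show ?meas
    using lim_prod discr(1) by (rule borel_measurable_LIMSEQ_real)
  have "(\<lambda>n. \<integral>w. (\<Prod>x\<in>N w \<inter> B. t n (\<kappa> n x)) \<partial>M) \<longlonglongrightarrow> (\<integral>w. (\<Prod>x\<in>N w \<inter> B. h x) \<partial>M)"
    using \<open>?meas\<close> discr(1) lim_prod t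
    by (intro integral_dominated_convergence[where w="\<lambda>_. 1"]) (auto intro!: prod_le_1 simp: abs_prod)
  moreover have "(\<lambda>n. \<integral>x. indicator B x * (1 - t n (\<kappa> n x)) \<partial>lborel) \<longlonglongrightarrow> (\<integral>x. indicator B x * (1 - h x) \<partial>lborel)"
  proof (rule integral_dominated_convergence[where w="indicator B"])
    show "integrable lborel (indicator B :: 'a \<Rightarrow> real)"
      using B emeasure_bounded_finite by (intro integrable_real_indicator) auto
    show "AE x in lborel. (\<lambda>n. indicator B x * (1 - t n (\<kappa> n x))) \<longlonglongrightarrow> indicator B x * (1 - h x)"
      by (intro AE_I2 tendsto_intros lim)
    show "AE x in lborel. norm (indicator B x * (1 - t n (\<kappa> n x))) \<le> indicator B x" for n
      using t by (auto simp: indicator_def)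
  qed measurable
  then have "(\<lambda>n. exp (- (l * (\<integral>x. indicator B x * (1 - t n (\<kappa> n x)) \<partial>lborel)))) \<longlonglongrightarrow>
      exp (- (l * (\<integral>x. indicator B x * (1 - h x) \<partial>lborel)))"
    by (intro tendsto_intros)
  ultimately show ?int
    unfolding discr(2) by (rule LIMSEQ_unique)
qed

subsection \<open>Area of a disk not covered by its translate\<close>

lemma bounded_borel_fmeasurable:
  fixes A :: "'a::euclidean_space set"
  assumes "A \<in> sets borel" "bounded A"
  shows "A \<in> fmeasurable lborel"
proof (rule fmeasurableI)
  show "A \<in> sets lborel" using assms by simp
  show "emeasure lborel A < \<infinity>" using emeasure_bounded_finite[OF assms(2)] by simp
qed

lemma emeasure_lborel_translation:
  fixes A :: "'a::euclidean_space set"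
  assumes "A \<in> sets borel"
  shows "emeasure lborel {x. x + a \<in> A} = emeasure lborel A"
proof -
  have "emeasure lborel A = emeasure (distr lborel borel ((+) a)) A"
    by (simp add: lborel_distr_plus)
  also have "\<dots> = emeasure lborel {x. x + a \<in> A}"
    using assms by (subst emeasure_distr) (auto simp: vimage_def add.commute)
  finally show ?thesis ..
qed

text \<open>Pass through the intermediate ball \<open>cball u r\<close>: what
  \<open>cball (u + v) r\<close> adds to it is a translate by \<open>u\<close> of
  \<open>cball v r - cball 0 r\<close>.\<close>

lemma measure_cball_diff_subadditive:
  fixes u v :: "'a::euclidean_space"
  shows "measure lborel (cball (u + v) r - cball 0 r) \<le>
    measure lborel (cball u r - cball 0 r) + measure lborel (cball v r - cball 0 r)"
proof -
  have fin: "cball a r - cball b r \<in> fmeasurable lborel" for a b :: 'a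
    by (intro bounded_borel_fmeasurable bounded_diff bounded_cball) simp
  have dist_shift: "dist (u + a) (x + u) = dist a x" "dist u (x + u) = norm x" for a x :: 'a
    by (metis add.commute dist_add_cancel) (simp add: dist_norm)
  have "measure lborel (cball (u + v) r - cball 0 r) \<le>
      measure lborel ((cball u r - cball 0 r) \<union> (cball (u + v) r - cball u r))"
    using fin by (intro measure_mono_fmeasurable) auto
  also have "\<dots> \<le> measure lborel (cball u r - cball 0 r) + measure lborel (cball (u + v) r - cball u r)"
    by (rule measure_Un_le) auto
  also have "measure lborel (cball (u + v) r - cball u r) =
      measure lborel {x. x + u \<in> cball (u + v) r - cball u r}"
    unfolding measure_def by (subst emeasure_lborel_translation) auto
  also have "{x. x + u \<in> cball (u + v) r - cball u r} = cball v r - cball 0 r"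
    by (auto simp: dist_shift)
  finally show ?thesis .
qed

text \<open>
  Enough copies of a short translation move the ball off itself, so by subadditivity a single
  one uncovers a proportional share of it.
\<close>

lemma measure_cball_diff_ge:
  fixes v :: "'a::euclidean_space"
  assumes r: "r > 0" and v: "norm v \<le> 2 * r"
  shows "norm v * measure lborel (cball (0::'a) r) \<le> 4 * r * measure lborel (cball v r - cball 0 r)"
proof (cases "v = 0")
  case False
  \<comment> \<open>The least \<open>n\<close> with \<open>n * norm v > 2 * r\<close>, so that the
    closed balls are disjoint. Since \<open>norm v \<le> 2 * r\<close>, it is at most
    \<open>4 * r / norm v\<close>, which is the source of the factor 4.\<close>
  define n where "n = nat \<lfloor>2 * r / norm v\<rfloor> + 1"
  have multiple: "measure lborel (cball (real n *\<^sub>R v) r - cball 0 r) \<le>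
      real n * measure lborel (cball v r - cball 0 r)" for n
  proof (induction n)
    case (Suc n)
    then show ?case
      using measure_cball_diff_subadditive[of v "real n *\<^sub>R v" r] by (simp add: algebra_simps)
  qed simp
  have "2 * r / norm v < real n" unfolding n_def by linarith
  then have far: "2 * r < norm (real n *\<^sub>R v)" using False by (simp add: field_simps)
  have "cball (real n *\<^sub>R v) r \<inter> cball 0 r = {}"
  proof (rule ccontr)
    assume "cball (real n *\<^sub>R v) r \<inter> cball 0 r \<noteq> {}"
    then obtain x where x: "dist (real n *\<^sub>R v) x \<le> r" "dist x 0 \<le> r" by (auto simp: dist_commute)
    then show False using far dist_triangle[of "real n *\<^sub>R v" 0 x] by simp
  qed
  then have "cball (real n *\<^sub>R v) r - cball 0 r = cball (real n *\<^sub>R v) r" by auto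
  then have le: "measure lborel (cball (0::'a) r) \<le> real n * measure lborel (cball v r - cball 0 r)"
    using multiple[of n] r by (simp add: content_cball)
  have "1 \<le> 2 * r / norm v" using v False by (simp add: field_simps)
  moreover have "real n \<le> 2 * r / norm v + 1" 
    using r unfolding n_def by (simp add: of_nat_nat)
  moreover have "4 * r / norm v = 2 * r / norm v + 2 * r / norm v" by simp
  ultimately have "real n \<le> 4 * r / norm v" by linarith
  then have "real n * norm v \<le> 4 * r" using False by (simp add: field_simps)
  then have "norm v * (real n * measure lborel (cball v r - cball 0 r)) \<le> 4 * r * measure lborel (cball v r - cball 0 r)"
    by (subst mult.assoc[symmetric], intro mult_right_mono) (auto simp: mult.commute)
  then show ?thesis
    using mult_left_mono[OF le norm_ge_zero[of v]] by linarith
qed (use r in simp)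

text \<open>Shrinking the translated disk to radius \<open>r'\<close> loses at most the annulus
  between the two radii, whose area is at most \<open>2 * pi * r * (r - r')\<close>.\<close>

lemma measure_cball_diff_ge_plane:
  fixes q :: "real ^ 2"
  assumes r: "0 < r" and r': "0 \<le> r'" "r' \<le> r" and q: "norm q \<le> 2 * r"
  shows "pi * r * norm q / 4 - 2 * pi * r * (r - r') \<le> measure lborel (cball q r' - cball 0 r)"
proof -
  have area: "measure lborel (cball p s) = pi * s ^ 2" if "s \<ge> 0" for p :: "real ^ 2" and s
    using that by (simp add: content_cball unit_ball_vol_2)
  have sub: "cball q r' \<subseteq> cball q r" using r' by auto
  have "pi * r * norm q / 4 \<le> measure lborel (cball q r - cball 0 r)"
    using measure_cball_diff_ge[OF r q] r by (simp add: area power2_eq_square field_simps)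
  also have "\<dots> \<le> measure lborel ((cball q r' - cball 0 r) \<union> (cball q r - cball q r'))"
    by (intro measure_mono_fmeasurable bounded_borel_fmeasurable) (auto intro: bounded_subset[OF bounded_cball])
  also have "\<dots> \<le> measure lborel (cball q r' - cball 0 r) + measure lborel (cball q r - cball q r')"
    by (rule measure_Un_le) auto
  also have "measure lborel (cball q r - cball q r') = pi * (r ^ 2 - r' ^ 2)"
    using r r' sub by (subst measurable_measure_Diff) (auto simp: bounded_borel_fmeasurable area algebra_simps)
  also have "\<dots> \<le> pi * (2 * r * (r - r'))"
  proof -
    have "2 * r * (r - r') - (r ^ 2 - r' ^ 2) = (r - r') ^ 2" by (simp add: power2_eq_square algebra_simps)
    then show ?thesis using zero_le_power2[of "r - r'"] by (intro mult_left_mono) (linarith, simp)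
  qed
  finally show ?thesis by (simp add: algebra_simps)
qed

subsection \<open>Void probabilities of a marked Poisson process\<close>

lemma measurable_measure_section:
  assumes "prob_space \<nu>" and "sets \<nu> = sets N" and "C \<in> sets (M \<Otimes>\<^sub>M N)"
  shows "(\<lambda>x. measure \<nu> (Pair x -` C)) \<in> borel_measurable M"
proof -
  interpret prob_space \<nu> by fact
  have "C \<in> sets (M \<Otimes>\<^sub>M \<nu>)"
    using assms sets_pair_measure_cong[of M M \<nu> N] by simp
  then have [measurable]: "(\<lambda>x. emeasure \<nu> (Pair x -` C)) \<in> borel_measurable M"
    by (rule measurable_emeasure_Pair)
  show ?thesis
    unfolding measure_def by measurable
qed

lemma sets_PiM_pair_avoiding:
  fixes C :: "('b::topological_space \<times> 'c::topological_space) set" and I :: "nat set"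
  assumes "C \<in> sets (borel \<Otimes>\<^sub>M borel)"
  defines "N \<equiv> Pi\<^sub>M UNIV (\<lambda>_. borel) \<Otimes>\<^sub>M Pi\<^sub>M UNIV (\<lambda>_. borel)"
  shows "{z \<in> space N. \<forall>i\<in>I. (fst z i, snd z i) \<notin> C} \<in> sets N"
proof -
  have "(\<lambda>z. fst z i) \<in> measurable N borel" "(\<lambda>z. snd z i) \<in> measurable N borel" for i
    unfolding N_def
    by (rule measurable_compose[OF measurable_fst] measurable_compose[OF measurable_snd], rule measurable_component_singleton, simp)+
  then have "(\<lambda>z. (fst z i, snd z i)) \<in> measurable N (borel \<Otimes>\<^sub>M borel)" for i
    by (rule measurable_Pair)
  from measurable_sets[OF this sets.compl_sets[OF assms(1)]]
  have "{z \<in> space N. (fst z i, snd z i) \<notin> C} \<in> sets N" for i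
    by (rule back_subst[where P="\<lambda>A. A \<in> _"]) (auto simp: space_pair_measure)
  then show ?thesis
    by (intro sets.sets_Collect_countable_Ball) auto
qed

text \<open>By independence the joint law of the two sequences is a product, so Tonelli allows the
  transmitters to be frozen. The fibre over a frozen sequence is a cylinder in finitely many
  coordinates, with the product of the single avoidance probabilities as its measure.\<close>

lemma (in prob_space) independent_marks_void_probability:
  fixes X :: "nat \<Rightarrow> 'a \<Rightarrow> 'b::second_countable_topology" and D :: "nat \<Rightarrow> 'a \<Rightarrow> 'b"
  assumes X: "\<And>i. random_variable borel (X i)"
    and D: "\<And>i. random_variable borel (D i)" "indep_vars (\<lambda>_. borel) D UNIV" "\<And>i. distr M borel (D i) = \<nu>"
    and XD: "indep_var (Pi\<^sub>M UNIV (\<lambda>_. borel)) (\<lambda>w i. X i w) (Pi\<^sub>M UNIV (\<lambda>_. borel)) (\<lambda>w i. D i w)"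
    and C: "C \<in> sets (borel \<Otimes>\<^sub>M borel)"
  shows "prob {w \<in> space M. \<forall>i<n. (X i w, D i w) \<notin> C} =
    (\<integral>w. (\<Prod>i<n. 1 - measure \<nu> (Pair (X i w) -` C)) \<partial>M)"
proof -
  let ?P = "Pi\<^sub>M (UNIV :: nat set) (\<lambda>_. borel :: 'b measure)"
  let ?Q = "Pi\<^sub>M (UNIV :: nat set) (\<lambda>_. borel :: 'b measure)"
  note [measurable] = X D(1) C
  have X_seq [measurable]: "(\<lambda>w i. X i w) \<in> measurable M ?P"
    and D_seq [measurable]: "(\<lambda>w i. D i w) \<in> measurable M ?Q"
    using indep_var_rv1[OF XD] indep_var_rv2[OF XD] by auto
  have \<nu>: "prob_space \<nu>" unfolding D(3)[of 0, symmetric] by (rule prob_space_distr[OF D(1)])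
  have sets_\<nu> [measurable_cong]: "sets \<nu> = sets borel" unfolding D(3)[of 0, symmetric] by simp
  have space_\<nu>: "space \<nu> = UNIV" unfolding D(3)[of 0, symmetric] by simp
  interpret \<nu>: prob_space \<nu> by (rule \<nu>)
  interpret \<nu>s: product_prob_space "\<lambda>_. \<nu>" UNIV ..
  have distr_D: "distr M ?Q (\<lambda>w i. D i w) = Pi\<^sub>M UNIV (\<lambda>_. \<nu>)"
    using D(2) indep_vars_iff_distr_eq_PiM[where I=UNIV and M'="\<lambda>_. borel" and X=D] D(1) by (simp add: D(3) restrict_def)
  have sec [measurable]: "Pair x -` C \<in> sets borel" for x
    using C by (rule sets_Pair1)
  define u where "u x = measure \<nu> (Pair x -` C)" for x
  have u_meas [measurable]: "u \<in> borel_measurable borel"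
    unfolding u_def using measurable_measure_section[OF \<nu> sets_\<nu> C] by simp
  have u01: "0 \<le> u x" "u x \<le> 1" for x by (auto simp: u_def)
  define W where "W = {z \<in> space (?P \<Otimes>\<^sub>M ?Q). \<forall>i\<in>{..<n}. (fst z i, snd z i) \<notin> C}"
  have W [measurable]: "W \<in> sets (?P \<Otimes>\<^sub>M ?Q)"
    unfolding W_def using C by (rule sets_PiM_pair_avoiding)
  have fibre: "emeasure (Pi\<^sub>M UNIV (\<lambda>_. \<nu>)) (Pair x -` W) = (\<Prod>i<n. ennreal (1 - u (x i)))" for x
  proof -
    have "Pair x -` W = {d \<in> space (Pi\<^sub>M UNIV (\<lambda>_. \<nu>)). \<forall>i\<in>{..<n}. d i \<in> - (Pair (x i) -` C)}"
      by (auto simp: W_def space_pair_measure space_PiM space_\<nu>)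
    also have "emeasure (Pi\<^sub>M UNIV (\<lambda>_. \<nu>)) \<dots> = (\<Prod>i<n. emeasure \<nu> (- (Pair (x i) -` C)))"
      by (rule \<nu>s.emeasure_PiM_Collect) auto
    also have "\<dots> = (\<Prod>i<n. ennreal (1 - u (x i)))"
      using \<nu>.prob_compl[of "Pair (x _) -` C"]
      by (intro prod.cong) (auto simp: \<nu>.emeasure_eq_measure u_def space_\<nu> Compl_eq_Diff_UNIV)
    finally show ?thesis .
  qed
  have "emeasure M {w \<in> space M. \<forall>i<n. (X i w, D i w) \<notin> C} =
      emeasure (distr M (?P \<Otimes>\<^sub>M ?Q) (\<lambda>w. (\<lambda>i. X i w, \<lambda>i. D i w))) W"
    by (subst emeasure_distr[OF _ W]) (auto simp: W_def space_pair_measure space_PiM intro!: arg_cong[where f="emeasure M"])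
  also have "distr M (?P \<Otimes>\<^sub>M ?Q) (\<lambda>w. (\<lambda>i. X i w, \<lambda>i. D i w)) =
      distr M ?P (\<lambda>w i. X i w) \<Otimes>\<^sub>M Pi\<^sub>M UNIV (\<lambda>_. \<nu>)"
    using XD unfolding indep_var_distribution_eq distr_D by simp
  also have "emeasure \<dots> W = (\<integral>\<^sup>+x. emeasure (Pi\<^sub>M UNIV (\<lambda>_. \<nu>)) (Pair x -` W) \<partial>distr M ?P (\<lambda>w i. X i w))"
    by (rule \<nu>s.emeasure_pair_measure_alt) measurable
  also have "\<dots> = (\<integral>\<^sup>+w. (\<Prod>i<n. ennreal (1 - u (X i w))) \<partial>M)"
    unfolding fibre by (subst nn_integral_distr) auto
  finally have "emeasure M {w \<in> space M. \<forall>i<n. (X i w, D i w) \<notin> C} = (\<integral>\<^sup>+w. (\<Prod>i<n. ennreal (1 - u (X i w))) \<partial>M)" .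
  then have "ennreal (prob {w \<in> space M. \<forall>i<n. (X i w, D i w) \<notin> C}) = (\<integral>\<^sup>+w. ennreal (\<Prod>i<n. 1 - u (X i w)) \<partial>M)"
    using u01 by (simp add: emeasure_eq_measure prod_ennreal)
  then show ?thesis
    using u01 unfolding u_def[symmetric]
    by (subst integral_eq_nn_integral) (auto intro!: prod_nonneg simp flip: \<open>ennreal _ = _\<close>)
qed

text \<open>Points outside \<open>B\<close> contribute the factor 1, so as \<open>n\<close> grows
  the products over indices become stationary at a finite product over points. This is the
  generating functional at \<open>h\<close>, the probability that the mark of a point avoids
  \<open>C\<close>.\<close>

lemma (in prob_space) marked_poisson_void_probability:
  fixes X :: "nat \<Rightarrow> 'a \<Rightarrow> 'b::euclidean_space" and D :: "nat \<Rightarrow> 'a \<Rightarrow> 'b"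
  assumes X: "\<And>i. random_variable borel (X i)" "\<And>w. w \<in> space M \<Longrightarrow> inj (\<lambda>i. X i w)"
      "homogeneous_poisson_process M l (\<lambda>w. range (\<lambda>i. X i w))"
    and D: "\<And>i. random_variable borel (D i)" "indep_vars (\<lambda>_. borel) D UNIV" "\<And>i. distr M borel (D i) = \<nu>"
    and XD: "indep_var (Pi\<^sub>M UNIV (\<lambda>_. borel)) (\<lambda>w i. X i w) (Pi\<^sub>M UNIV (\<lambda>_. borel)) (\<lambda>w i. D i w)"
    and C: "C \<in> sets (borel \<Otimes>\<^sub>M borel)"
    and B: "B \<in> sets borel" "bounded B" "\<And>x. x \<notin> B \<Longrightarrow> measure \<nu> (Pair x -` C) = 0"
  shows "prob {w \<in> space M. \<forall>i. (X i w, D i w) \<notin> C} =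
    exp (- (l * (\<integral>x. measure \<nu> (Pair x -` C) \<partial>lborel)))"
proof -
  note [measurable] = X(1) D(1) C
  have \<nu>: "prob_space \<nu>" unfolding D(3)[of 0, symmetric] by (rule prob_space_distr[OF D(1)])
  have sets_\<nu> [measurable_cong]: "sets \<nu> = sets borel" unfolding D(3)[of 0, symmetric] by simp
  interpret \<nu>: prob_space \<nu> by (rule \<nu>)
  define h where "h x = 1 - measure \<nu> (Pair x -` C)" for x
  have [measurable]: "Pair x -` C \<in> sets borel" for x
    using C by (rule sets_Pair1)
  have h_meas [measurable]: "h \<in> borel_measurable borel"
    unfolding h_def using measurable_measure_section[OF \<nu> sets_\<nu> C] by simp
  have h01: "0 \<le> h x" "h x \<le> 1" for x by (auto simp: h_def)
  let ?T = "\<lambda>w. range (\<lambda>i. X i w)"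
  note pgfl = poisson_generating_functional[OF prob_space_axioms X(3) B(1,2) h_meas h01]
  define E where "E n = {w \<in> space M. \<forall>i<n. (X i w, D i w) \<notin> C}" for n
  have [measurable]: "E n \<in> events" for n unfolding E_def by measurable
  have "(\<lambda>n. prob (E n)) \<longlonglongrightarrow> prob (\<Inter>n. E n)"
    by (intro finite_Lim_measure_decseq) (auto simp: decseq_def E_def)
  also have "(\<Inter>n. E n) = {w \<in> space M. \<forall>i. (X i w, D i w) \<notin> C}"
    by (auto simp: E_def)
  finally have "(\<lambda>n. \<integral>w. (\<Prod>i<n. h (X i w)) \<partial>M) \<longlonglongrightarrow> prob {w \<in> space M. \<forall>i. (X i w, D i w) \<notin> C}"
    unfolding E_def h_def independent_marks_void_probability[OF X(1) D XD C] .
  moreover have "(\<lambda>n. \<integral>w. (\<Prod>i<n. h (X i w)) \<partial>M) \<longlonglongrightarrow> (\<integral>w. (\<Prod>x\<in>?T w \<inter> B. h x) \<partial>M)"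
  proof (rule integral_dominated_convergence[where w="\<lambda>_. 1"])
    show "AE w in M. (\<lambda>n. \<Prod>i<n. h (X i w)) \<longlonglongrightarrow> (\<Prod>x\<in>?T w \<inter> B. h x)"
    proof (rule AE_I2)
      fix w assume w: "w \<in> space M"
      define I where "I = {i. X i w \<in> B}"
      have image: "?T w \<inter> B = (\<lambda>i. X i w) ` I" by (auto simp: I_def)
      \<comment> \<open>The law describes the set of points and the product runs over indices;
        injectivity identifies the two without multiplicities.\<close>
      have inj: "inj_on (\<lambda>i. X i w) I" using X(2)[OF w] by (rule inj_on_subset) simp
      have "finite (?T w \<inter> B)"
        using X(3) B w by (auto simp: homogeneous_poisson_process_def point_process_def)
      then have "finite I" unfolding image using inj by (rule finite_imageD)
      then obtain n0 where n0: "I \<subseteq> {..<n0}" using finite_nat_iff_bounded by blast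
      have "(\<Prod>i<n. h (X i w)) = (\<Prod>x\<in>?T w \<inter> B. h x)" if "n \<ge> n0" for n
      proof -
        have "(\<Prod>i<n. h (X i w)) = (\<Prod>i\<in>I. h (X i w))"
          using n0 that by (intro prod.mono_neutral_right) (auto simp: I_def h_def B(3))
        then show ?thesis unfolding image by (subst prod.reindex[OF inj]) simp
      qed
      then show "(\<lambda>n. \<Prod>i<n. h (X i w)) \<longlonglongrightarrow> (\<Prod>x\<in>?T w \<inter> B. h x)"
        by (intro tendsto_eventually eventually_sequentiallyI)
    qed
    show "AE w in M. norm (\<Prod>i<n. h (X i w)) \<le> 1" for n
      using h01 by (auto intro!: prod_le_1 simp: abs_prod)
  qed (use pgfl(1) in auto)
  ultimately have "prob {w \<in> space M. \<forall>i. (X i w, D i w) \<notin> C} =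
      exp (- (l * (\<integral>x. indicator B x * (1 - h x) \<partial>lborel)))"
    unfolding pgfl(2) by (rule LIMSEQ_unique)
  also have "(\<lambda>x. indicator B x * (1 - h x)) = (\<lambda>x. measure \<nu> (Pair x -` C))"
    using B(3) by (auto simp: h_def indicator_def fun_eq_iff)
  finally show ?thesis .
qed

subsection \<open>Mean degree in the heterogeneous network\<close>

text \<open>One geometric series for each sign, with index 0 counted twice.\<close>

lemma sum_int_power_abs_le:
  fixes \<theta> :: real
  assumes "0 \<le> \<theta>" "\<theta> < 1"
  shows "(\<Sum>i = - int n..int n. \<theta> ^ nat \<bar>i\<bar>) \<le> 2 / (1 - \<theta>)"
proof -
  have geo: "(\<Sum>k\<le>n. \<theta> ^ k) \<le> 1 / (1 - \<theta>)"
    using sum_le_suminf[OF summable_geometric, of \<theta> "{..n}"] suminf_geometric[of \<theta>] assms by simp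
  have "{- int n..int n} = int ` {..n} \<union> (\<lambda>k. - int k) ` {..n}"
  proof (intro set_eqI iffI)
    fix i assume "i \<in> {- int n..int n}"
    then have "nat \<bar>i\<bar> \<le> n" "i = int (nat \<bar>i\<bar>) \<or> i = - int (nat \<bar>i\<bar>)" by auto
    then show "i \<in> int ` {..n} \<union> (\<lambda>k. - int k) ` {..n}" by blast
  qed auto
  moreover have "0 \<le> (\<Sum>i\<in>int ` {..n} \<inter> (\<lambda>k. - int k) ` {..n}. \<theta> ^ nat \<bar>i\<bar>)"
    using assms by (intro sum_nonneg) auto
  ultimately have "(\<Sum>i = - int n..int n. \<theta> ^ nat \<bar>i\<bar>) \<le>
      (\<Sum>i\<in>int ` {..n}. \<theta> ^ nat \<bar>i\<bar>) + (\<Sum>i\<in>(\<lambda>k. - int k) ` {..n}. \<theta> ^ nat \<bar>i\<bar>)"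
    using sum.union_inter[of "int ` {..n}" "(\<lambda>k. - int k) ` {..n}" "\<lambda>i. \<theta> ^ nat \<bar>i\<bar>"] by simp
  also have "\<dots> = (\<Sum>k\<le>n. \<theta> ^ k) + (\<Sum>k\<le>n. \<theta> ^ k)"
    by (simp add: sum.reindex inj_on_def)
  finally show ?thesis using geo by simp
qed

lemma norm_le_two_components:
  fixes x :: "real ^ 2"
  shows "norm x \<le> \<bar>x $ 1\<bar> + \<bar>x $ 2\<bar>"
  using norm_le_l1_cart[of x] by (simp add: sum_2)

lemma measure_lborel_cbox_plane:
  fixes a b :: "real ^ 2"
  assumes "a $ 1 \<le> b $ 1" "a $ 2 \<le> b $ 2"
  shows "measure lborel (cbox a b) = (b $ 1 - a $ 1) * (b $ 2 - a $ 2)"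
proof -
  have "cbox a b \<noteq> {}" using assms by (auto simp: interval_ne_empty_cart forall_2)
  then show ?thesis by (simp add: content_cbox_cart UNIV_2)
qed

lemma uniform_measure_cball_disjoint:
  fixes A :: "'a::euclidean_space set"
  assumes "A \<in> sets borel" "A \<inter> cball 0 R = {}"
  shows "measure (uniform_measure lborel (cball 0 R)) A = 0"
  using assms by (simp add: measure_def emeasure_uniform_measure Int_commute)

lemma sets_pair_sum_in:
  fixes \<Delta> :: "'a::euclidean_space set"
  assumes "\<Delta> \<in> sets borel"
  shows "{(x, d). x + d \<in> \<Delta>} \<in> sets ((borel :: 'a measure) \<Otimes>\<^sub>M borel)"
proof -
  note [measurable] = assms
  have "{z \<in> space ((borel :: 'a measure) \<Otimes>\<^sub>M borel). fst z + snd z \<in> \<Delta>} \<in> sets (borel \<Otimes>\<^sub>M borel)"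
    by measurable
  then show ?thesis
    by (rule back_subst[where P="\<lambda>A. A \<in> _"]) (auto simp: space_pair_measure)
qed

text \<open>By Tonelli one may fix \<open>d\<close> first, and then the section is a translate of
  \<open>\<Delta>\<close>. Hence receivers have the same intensity as transmitters, whatever the law
  of the displacement.\<close>

lemma uniform_displacement_section_integral:
  fixes \<Delta> :: "'a::euclidean_space set"
  assumes \<nu>: "prob_space \<nu>" "sets \<nu> = sets borel" and \<Delta>: "\<Delta> \<in> sets borel"
  shows "(\<integral>\<^sup>+x. emeasure \<nu> (Pair x -` {(x, d). x + d \<in> \<Delta>}) \<partial>lborel) = emeasure lborel \<Delta>"
proof -
  interpret \<nu>: prob_space \<nu> by fact
  interpret pair_sigma_finite lborel \<nu> ..
  have meas: "{(x, d). x + d \<in> \<Delta>} \<in> sets (lborel \<Otimes>\<^sub>M \<nu>)"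
    using sets_pair_sum_in[OF \<Delta>] sets_pair_measure_cong[of lborel borel \<nu> borel] \<nu>(2) by simp
  have "(\<integral>\<^sup>+x. emeasure \<nu> (Pair x -` {(x, d). x + d \<in> \<Delta>}) \<partial>lborel) =
      (\<integral>\<^sup>+d. emeasure lborel ((\<lambda>x. (x, d)) -` {(x, d). x + d \<in> \<Delta>}) \<partial>\<nu>)"
    using \<nu>.emeasure_pair_measure_alt[OF meas] emeasure_pair_measure_alt2[OF meas] by simp
  also have "\<dots> = (\<integral>\<^sup>+d. emeasure lborel \<Delta> \<partial>\<nu>)"
  proof (rule nn_integral_cong)
    fix d
    show "emeasure lborel ((\<lambda>x. (x, d)) -` {(x, d). x + d \<in> \<Delta>}) = emeasure lborel \<Delta>"
      using emeasure_lborel_translation[OF \<Delta>, of d] by (simp add: vimage_def)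
  qed
  finally show ?thesis by (simp add: \<nu>.emeasure_space_1)
qed

lemma floor_cell_bounds:
  fixes t r :: real
  assumes "r > 0"
  shows "real_of_int \<lfloor>r * t\<rfloor> / r \<le> t" "t \<le> (real_of_int \<lfloor>r * t\<rfloor> + 1) / r"
  using assms floor_correct[of "r * t"] by (simp_all add: field_simps)

section \<open>Void probabilities of the primary network\<close>

context heterogeneous_network
begin

abbreviation \<nu> :: "(real ^ 2) measure" where
  "\<nu> \<equiv> uniform_measure lborel (cball 0 R\<^sub>p)"

text \<open>Transmitter and receiver conditions are both restrictions on the pair of a position and
  its displacement, so seeing an opportunity becomes a void event of one marked process.\<close>

definition avoids :: "((real ^ 2) \<times> (real ^ 2)) set \<Rightarrow> 'w set" where
  "avoids C = {w \<in> space M. \<forall>i. (X i w, D i w) \<notin> C}"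

lemma displacement_measurable: "D i \<in> borel_measurable M"
  using displacement_indep by (auto simp: indep_vars_def)

lemma prob_space_displacement: "prob_space \<nu>"
  using prob_space_distr[OF displacement_measurable[of 0]] by (simp add: displacement_uniform)

text \<open>Membership in the sigma-algebra generated by the primary network is what the
  independence from \<open>S\<close> will be applied to.\<close>

lemma avoids_primary_event:
  assumes "C \<in> sets (borel \<Otimes>\<^sub>M borel)"
  shows "avoids C \<in> sets (vimage_algebra (space M) (\<lambda>w. (\<lambda>i. X i w, \<lambda>i. D i w))
            (Pi\<^sub>M UNIV (\<lambda>_. borel) \<Otimes>\<^sub>M Pi\<^sub>M UNIV (\<lambda>_. borel)))"
proof -
  let ?P = "Pi\<^sub>M (UNIV :: nat set) (\<lambda>_. borel :: (real ^ 2) measure)"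
  note [measurable] = assms
  have "{z \<in> space (?P \<Otimes>\<^sub>M ?P). \<forall>i\<in>UNIV. (fst z i, snd z i) \<notin> C} \<in> sets (?P \<Otimes>\<^sub>M ?P)"
    using assms by (rule sets_PiM_pair_avoiding)
  from in_vimage_algebra[OF this, of "\<lambda>w. (\<lambda>i. X i w, \<lambda>i. D i w)" "space M"]
  show ?thesis
    by (rule back_subst[where P="\<lambda>A. A \<in> _"]) (auto simp: avoids_def space_pair_measure space_PiM)
qed

lemma avoids_event [measurable]:
  assumes "C \<in> sets (borel \<Otimes>\<^sub>M borel)"
  shows "avoids C \<in> events"
  \<comment> \<open>\<open>indep_set\<close> includes that both families consist of events.\<close>
  using secondary_indep_primary avoids_primary_event[OF assms]
  by (auto simp: indep_set_def indep_sets_def split: bool.splits)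

text \<open>\<open>C\<close> may be unbounded, because a remote transmitter can have a huge
  displacement. Only displacements in the disk of radius \<open>R\<^sub>p\<close> carry mass, so
  \<open>R\<close> bounds positions for these alone.\<close>

lemma prob_avoids:
  assumes C: "C \<in> sets (borel \<Otimes>\<^sub>M borel)"
    and R: "\<And>x d. (x, d) \<in> C \<Longrightarrow> norm d \<le> R\<^sub>p \<Longrightarrow> norm x \<le> R"
  shows "integrable lborel (\<lambda>x. measure \<nu> (Pair x -` C))"
    and "prob (avoids C) = exp (- (l\<^sub>T * (\<integral>x. measure \<nu> (Pair x -` C) \<partial>lborel)))"
proof -
  interpret \<nu>: prob_space \<nu> by (rule prob_space_displacement)
  have zero: "measure \<nu> (Pair x -` C) = 0" if "x \<notin> cball 0 R" for x
    using that R by (intro uniform_measure_cball_disjoint sets_Pair1[OF C]) (auto simp: dist_norm)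
  have "integrable lborel (indicator (cball 0 R) :: real ^ 2 \<Rightarrow> real)"
    by (intro integrable_real_indicator emeasure_bounded_finite) auto
  then show "integrable lborel (\<lambda>x. measure \<nu> (Pair x -` C))"
  proof (rule Bochner_Integration.integrable_bound)
    show "(\<lambda>x. measure \<nu> (Pair x -` C)) \<in> borel_measurable lborel"
      using measurable_measure_section[OF prob_space_displacement _ C] by simp
    show "AE x in lborel. norm (measure \<nu> (Pair x -` C)) \<le> norm (indicator (cball 0 R) x :: real)"
      using zero by (auto simp: indicator_def)
  qed
  show "prob (avoids C) = exp (- (l\<^sub>T * (\<integral>x. measure \<nu> (Pair x -` C) \<partial>lborel)))"
    unfolding avoids_def
    by (rule marked_poisson_void_probability[OF transmitter_measurable transmitter_inj _
          displacement_measurable displacement_indep displacement_uniform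
          displacement_indep_transmitters C, where B="cball 0 R"])
      (use transmitters_poisson zero in \<open>simp_all add: transmitters_def[abs_def]\<close>)
qed

text \<open>The sections of the two sets overlap only outside the support of \<open>\<nu>\<close>,
  so their measures add. Integrating the new sections gives the area of \<open>\<Delta>\<close>, and
  the exponential splits.\<close>

lemma prob_avoids_receivers_Un:
  assumes C: "C \<in> sets (borel \<Otimes>\<^sub>M borel)"
    and R: "\<And>x d. (x, d) \<in> C \<Longrightarrow> norm d \<le> R\<^sub>p \<Longrightarrow> norm x \<le> R"
    and \<Delta>: "\<Delta> \<in> sets borel" "bounded \<Delta>"
    and disj: "\<And>x d. (x, d) \<in> C \<Longrightarrow> norm d \<le> R\<^sub>p \<Longrightarrow> x + d \<notin> \<Delta>"
  shows "prob (avoids (C \<union> {(x, d). x + d \<in> \<Delta>})) = prob (avoids C) * exp (- (l\<^sub>T * measure lborel \<Delta>))"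
proof -
  interpret \<nu>: prob_space \<nu> by (rule prob_space_displacement)
  let ?G = "{(x, d). x + d \<in> \<Delta>} :: ((real ^ 2) \<times> (real ^ 2)) set"
  have G: "?G \<in> sets (borel \<Otimes>\<^sub>M borel)" using \<Delta>(1) by (rule sets_pair_sum_in)
  obtain b where b: "\<And>x. x \<in> \<Delta> \<Longrightarrow> norm x \<le> b"
    using \<Delta>(2) by (auto simp: bounded_iff)
  have R_G: "norm x \<le> b + R\<^sub>p" if "(x, d) \<in> ?G" "norm d \<le> R\<^sub>p" for x d
    using that b[of "x + d"] norm_triangle_ineq4[of "x + d" d] by simp
  have R_Un: "norm x \<le> max R (b + R\<^sub>p)" if "(x, d) \<in> C \<union> ?G" "norm d \<le> R\<^sub>p" for x d
    using that R[of x d] R_G[of x d] by auto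
  have split: "measure \<nu> (Pair x -` (C \<union> ?G)) = measure \<nu> (Pair x -` C) + measure \<nu> (Pair x -` ?G)" for x
  proof -
    have C': "Pair x -` C \<in> sets \<nu>" and G': "Pair x -` ?G \<in> sets \<nu>"
      using sets_Pair1[OF C] sets_Pair1[OF G] by auto
    have "measure \<nu> (Pair x -` C \<inter> Pair x -` ?G) = 0"
      using C' G' disj by (intro uniform_measure_cball_disjoint) auto
    then show ?thesis
      using measure_Un3[of "Pair x -` C" \<nu> "Pair x -` ?G"] C' G' 
      by (simp add: \<nu>.fmeasurable_eq_sets vimage_Un)
  qed
  have "ennreal (\<integral>x. measure \<nu> (Pair x -` ?G) \<partial>lborel) = (\<integral>\<^sup>+x. emeasure \<nu> (Pair x -` ?G) \<partial>lborel)"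
    using prob_avoids(1)[OF G R_G] by (subst nn_integral_eq_integral[symmetric]) (auto simp: \<nu>.emeasure_eq_measure)
  also have "\<dots> = emeasure lborel \<Delta>"
    using \<Delta> by (intro uniform_displacement_section_integral prob_space_displacement) auto
  also have "\<dots> = ennreal (measure lborel \<Delta>)"
    using emeasure_bounded_finite[OF \<Delta>(2)] by (intro emeasure_eq_ennreal_measure) auto
  finally have "(\<integral>x. measure \<nu> (Pair x -` ?G) \<partial>lborel) = measure lborel \<Delta>"
    by (subst (asm) ennreal_inj) (auto intro!: integral_nonneg_AE)
  then have "(\<integral>x. measure \<nu> (Pair x -` (C \<union> ?G)) \<partial>lborel) = (\<integral>x. measure \<nu> (Pair x -` C) \<partial>lborel) + measure lborel \<Delta>"
    using prob_avoids(1)[OF C R] prob_avoids(1)[OF G R_G] unfolding split by simp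
  then have "prob (avoids (C \<union> ?G)) =
      exp (- (l\<^sub>T * ((\<integral>x. measure \<nu> (Pair x -` C) \<partial>lborel) + measure lborel \<Delta>)))"
    using prob_avoids(2)[OF sets.Un[OF C G] R_Un] by (simp only:)
  also have "\<dots> = prob (avoids C) * exp (- (l\<^sub>T * measure lborel \<Delta>))"
    by (simp add: prob_avoids(2)[of C R, OF C R] distrib_left exp_diff exp_minus divide_inverse)
  finally show ?thesis .
qed

definition origin_blockers :: "real \<Rightarrow> real \<Rightarrow> ((real ^ 2) \<times> (real ^ 2)) set" where
  "origin_blockers RI r = {(x, d). norm x \<le> RI \<or> norm (x + d) \<le> r}"

lemma sees_opportunity_origin_iff:
  assumes "w \<in> space M"
  shows "sees_opportunity (transmitters X w) (receivers X D w) RI r 0 \<longleftrightarrow> w \<in> avoids (origin_blockers RI r)"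
  using assms by (auto simp: sees_opportunity_def transmitters_def receivers_def avoids_def origin_blockers_def)

lemma sets_origin_blockers: "origin_blockers RI r \<in> sets (borel \<Otimes>\<^sub>M borel)"
proof -
  have "{z \<in> space (borel \<Otimes>\<^sub>M borel). norm (fst z) \<le> RI \<or> norm (fst z + snd z :: real ^ 2) \<le> r}
      \<in> sets (borel \<Otimes>\<^sub>M borel)"
    by measurable
  then show ?thesis
    by (rule back_subst[where P="\<lambda>A. A \<in> _"]) (auto simp: origin_blockers_def space_pair_measure)
qed

text \<open>This makes the conditioning event one of positive probability, so the normalisation can
  be cancelled.\<close>

lemma prob_avoids_origin_blockers_pos:
  assumes "0 < R\<^sub>p" "R\<^sub>I + R\<^sub>p \<le> r"
  shows "prob (avoids (origin_blockers R\<^sub>I r)) > 0"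
proof -
  have "norm x \<le> r + R\<^sub>p" if "(x, d) \<in> origin_blockers R\<^sub>I r" "norm d \<le> R\<^sub>p" for x d
    using that assms norm_triangle_ineq4[of "x + d" d] by (auto simp: origin_blockers_def)
  then show ?thesis
    using prob_avoids(2)[OF sets_origin_blockers, of R\<^sub>I r "r + R\<^sub>p"] by simp
qed

text \<open>\<open>q\<close> will be a cell corner, and \<open>2 / r\<close> bounds its distance to
  the points of the cell. Shrinking the disk by that much costs area at most
  \<open>2 * pi * r * (2 / r) = 4 * pi\<close>, which does not grow with \<open>r\<close>.\<close>

lemma prob_both_avoid_le:
  assumes l\<^sub>T: "0 < l\<^sub>T" and R: "0 < R\<^sub>p" "0 < R\<^sub>I" "R\<^sub>I + R\<^sub>p \<le> r" and r: "2 \<le> r"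
    and q: "norm q \<le> 2 * r"
  defines "\<Delta> \<equiv> cball q (r - 2 / r) - cball 0 r"
  shows "prob (avoids (origin_blockers R\<^sub>I r \<union> {(x, d). x + d \<in> \<Delta>})) \<le>
    prob (avoids (origin_blockers R\<^sub>I r)) * exp (4 * pi * l\<^sub>T - l\<^sub>T * pi / 4 * (r * norm q))"
proof -
  have \<Delta>: "\<Delta> \<in> sets borel" "bounded \<Delta>" unfolding \<Delta>_def by (auto intro: bounded_diff)
  have R_C: "norm x \<le> r + R\<^sub>p" if "(x, d) \<in> origin_blockers R\<^sub>I r" "norm d \<le> R\<^sub>p" for x d
    using that R norm_triangle_ineq4[of "x + d" d] by (auto simp: origin_blockers_def)
  \<comment> \<open>A transmitter within \<open>R\<^sub>I\<close> has its receiver within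
    \<open>R\<^sub>I + R\<^sub>p \<le> r\<close> of the origin, hence outside
    \<open>\<Delta>\<close>.\<close>
  have disj: "x + d \<notin> \<Delta>" if "(x, d) \<in> origin_blockers R\<^sub>I r" "norm d \<le> R\<^sub>p" for x d
    using that R norm_triangle_ineq[of x d] by (auto simp: origin_blockers_def \<Delta>_def)
  have "2 / r \<le> r" using r mult_mono[of 2 r 2 r] by (simp add: field_simps)
  then have "pi * r * norm q / 4 - 2 * pi * r * (r - (r - 2 / r)) \<le> measure lborel \<Delta>"
    unfolding \<Delta>_def using r q by (intro measure_cball_diff_ge_plane) auto
  then have "pi / 4 * (r * norm q) - 4 * pi \<le> measure lborel \<Delta>"
    using r by (simp add: algebra_simps)
  then have "l\<^sub>T * (pi / 4 * (r * norm q) - 4 * pi) \<le> l\<^sub>T * measure lborel \<Delta>"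
    using l\<^sub>T by (intro mult_left_mono) auto
  then have "- (l\<^sub>T * measure lborel \<Delta>) \<le> 4 * pi * l\<^sub>T - l\<^sub>T * pi / 4 * (r * norm q)"
    by (simp add: algebra_simps)
  moreover have "prob (avoids (origin_blockers R\<^sub>I r \<union> {(x, d). x + d \<in> \<Delta>})) =
      prob (avoids (origin_blockers R\<^sub>I r)) * exp (- (l\<^sub>T * measure lborel \<Delta>))"
    using sets_origin_blockers R_C \<Delta> disj by (rule prob_avoids_receivers_Un)
  ultimately show ?thesis
    by (auto intro!: mult_left_mono)
qed

text \<open>
  Secondary users are grouped into cells of side \<open>1 / r\<close>. All users of a cell that see an opportunity
  force the same slightly smaller disk around its corner to be free of receivers, at the cost of
  only a bounded factor in probability.
\<close>

definition cell_corner :: "real \<Rightarrow> int \<times> int \<Rightarrow> real ^ 2" where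
  "cell_corner r p = vector [of_int (fst p) / r, of_int (snd p) / r]"

text \<open>Closed boxes share edges; for an upper bound on the degree a covering suffices.\<close>

definition cell :: "real \<Rightarrow> int \<times> int \<Rightarrow> (real ^ 2) set" where
  "cell r p = cbox (cell_corner r p) (cell_corner r p + vector [1 / r, 1 / r])"

lemma measure_cell:
  assumes "0 < r"
  shows "measure lborel (cell r p) = 1 / r ^ 2"
  using assms unfolding cell_def
  by (subst measure_lborel_cbox_plane) (auto simp: power2_eq_square)

lemma dist_cell_corner_le:
  assumes "0 < r" "y \<in> cell r p"
  shows "dist y (cell_corner r p) \<le> 2 / r"
proof -
  have "\<bar>(y - cell_corner r p) $ 1\<bar> \<le> 1 / r" "\<bar>(y - cell_corner r p) $ 2\<bar> \<le> 1 / r"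
    using assms(2) by (auto simp: cell_def mem_box_cart forall_2 abs_le_iff)
  then show ?thesis
    using norm_le_two_components[of "y - cell_corner r p"] by (simp add: dist_norm)
qed

lemma mem_floor_cell:
  fixes y :: "real ^ 2"
  assumes "0 < r"
  shows "y \<in> cell r (\<lfloor>r * y $ 1\<rfloor>, \<lfloor>r * y $ 2\<rfloor>)"
  using floor_cell_bounds[OF assms, of "y $ 1"] floor_cell_bounds[OF assms, of "y $ 2"]
  by (simp add: cell_def cell_corner_def mem_box_cart forall_2 add_divide_distrib)

text \<open>The norm dominates both coordinates and hence their average. In this form the
  exponential decay splits into one geometric factor per coordinate, free of
  \<open>r\<close>.\<close>

lemma scaled_norm_cell_corner_ge:
  assumes "0 < r"
  shows "(\<bar>of_int (fst p)\<bar> + \<bar>of_int (snd p)\<bar>) / 2 \<le> r * norm (cell_corner r p)"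
proof -
  have "\<bar>of_int (fst p)\<bar> / r \<le> norm (cell_corner r p)" "\<bar>of_int (snd p)\<bar> / r \<le> norm (cell_corner r p)"
    using component_le_norm_cart[of "cell_corner r p" 1] component_le_norm_cart[of "cell_corner r p" 2] assms
    by (simp_all add: cell_corner_def)
  then show ?thesis using assms by (simp add: field_simps)
qed

definition cell_blockers :: "real \<Rightarrow> real \<Rightarrow> int \<times> int \<Rightarrow> ((real ^ 2) \<times> (real ^ 2)) set" where
  "cell_blockers RI r p = origin_blockers RI r \<union>
     {(x, d). x + d \<in> cball (cell_corner r p) (r - 2 / r) - cball 0 r}"

text \<open>The box makes the set finite and, since \<open>r * r\<close> bounds the scaled
  coordinates, contains every cell index that arises from \<open>norm y \<le> r\<close>. The norm
  condition is the range in which the area estimate holds.\<close>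

definition near_cells :: "real \<Rightarrow> (int \<times> int) set" where
  "near_cells r = {p \<in> {- int (nat \<lceil>r * r\<rceil> + 1)..int (nat \<lceil>r * r\<rceil> + 1)} \<times> {- int (nat \<lceil>r * r\<rceil> + 1)..int (nat \<lceil>r * r\<rceil> + 1)}.
     norm (cell_corner r p) \<le> 2 * r}"

lemma finite_near_cells: "finite (near_cells r)"
  unfolding near_cells_def by simp

lemma floor_cell_near:
  fixes y :: "real ^ 2"
  assumes r: "2 \<le> r" and y: "norm y \<le> r"
  shows "(\<lfloor>r * y $ 1\<rfloor>, \<lfloor>r * y $ 2\<rfloor>) \<in> near_cells r"
proof -
  have "2 / r \<le> r" using r mult_mono[of 2 r 2 r] by (simp add: field_simps)
  let ?p = "(\<lfloor>r * y $ 1\<rfloor>, \<lfloor>r * y $ 2\<rfloor>)"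
  have "norm (cell_corner r ?p) \<le> 2 * r"
    using dist_cell_corner_le[OF _ mem_floor_cell, of r y] r y \<open>2 / r \<le> r\<close>
      norm_triangle_sub[of "cell_corner r ?p" y] by (simp add: dist_norm norm_minus_commute)
  moreover have "\<lfloor>r * y $ i\<rfloor> \<in> {- int (nat \<lceil>r * r\<rceil> + 1)..int (nat \<lceil>r * r\<rceil> + 1)}" for i
  proof -
    have "\<bar>r * y $ i\<bar> \<le> r * r"
      using component_le_norm_cart[of y i] r y by (simp add: abs_mult)
    then show ?thesis by (auto simp: abs_le_iff) linarith+
  qed
  ultimately show ?thesis by (simp add: near_cells_def)
qed

lemma mem_avoids_cell_blockers:
  assumes r: "0 < r" and w: "w \<in> avoids (origin_blockers RI r)"
    and y: "y \<in> cell r p" "sees_opportunity (transmitters X w) (receivers X D w) RI r y"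
  shows "w \<in> avoids (cell_blockers RI r p)"
proof -
  have "X i w + D i w \<notin> cball (cell_corner r p) (r - 2 / r)" for i
  proof
    assume "X i w + D i w \<in> cball (cell_corner r p) (r - 2 / r)"
    \<comment> \<open>\<open>r - 2 / r\<close> is what remains of \<open>r\<close> after a move of
      at most \<open>2 / r\<close> from \<open>y\<close> to the corner.\<close>
    then have "dist y (X i w + D i w) \<le> r"
      using dist_cell_corner_le[OF r y(1)] dist_triangle[of y "X i w + D i w" "cell_corner r p"] by simp
    then show False using y(2) by (auto simp: sees_opportunity_def receivers_def)
  qed
  then show ?thesis using w by (auto simp: avoids_def cell_blockers_def)
qed

text \<open>Each summand is a count of \<open>S\<close> times an indicator that depends on the
  primary network alone, the form that independence can evaluate.\<close>

lemma degree_le_sum_cells: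
  assumes r: "2 \<le> r" and rp: "rp \<le> r" and w: "w \<in> space M"
  shows "degree_in (transmitters X w) (receivers X D w) (insert 0 (S w)) R\<^sub>I r rp 0 \<le>
    (\<Sum>p\<in>near_cells r. card (S w \<inter> cell r p) * indicator (avoids (cell_blockers R\<^sub>I r p)) w)"
proof -
  let ?L = "{y \<in> insert 0 (S w). linked (transmitters X w) (receivers X D w) R\<^sub>I r rp 0 y}"
  let ?J = "{p \<in> near_cells r. w \<in> avoids (cell_blockers R\<^sub>I r p)}"
  have "?L \<subseteq> (\<Union>p\<in>?J. S w \<inter> cell r p)"
  proof
    fix y assume "y \<in> ?L"
    \<comment> \<open>\<open>linked\<close> excludes \<open>y = 0\<close>, so the added user at the
      origin does not count itself.\<close>
    then have y: "y \<in> S w" "norm y \<le> r"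
      "sees_opportunity (transmitters X w) (receivers X D w) R\<^sub>I r 0"
      "sees_opportunity (transmitters X w) (receivers X D w) R\<^sub>I r y"
      using rp by (auto simp: linked_def)
    have c: "y \<in> cell r (\<lfloor>r * y $ 1\<rfloor>, \<lfloor>r * y $ 2\<rfloor>)" using r by (intro mem_floor_cell) simp
    have "w \<in> avoids (cell_blockers R\<^sub>I r (\<lfloor>r * y $ 1\<rfloor>, \<lfloor>r * y $ 2\<rfloor>))"
      using r y(3) w sees_opportunity_origin_iff[OF w]
      by (intro mem_avoids_cell_blockers[OF _ _ c y(4)]) auto
    then show "y \<in> (\<Union>p\<in>?J. S w \<inter> cell r p)"
      using c y(1) floor_cell_near[OF r y(2)] by blast
  qed
  moreover have fin: "finite (S w \<inter> cell r p)" for p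
    using secondary_poisson w by (auto simp: homogeneous_poisson_process_def point_process_def cell_def bounded_cbox)
  ultimately have "card ?L \<le> card (\<Union>p\<in>?J. S w \<inter> cell r p)"
    by (intro card_mono finite_UN_I) (auto simp: finite_near_cells)
  also have "\<dots> \<le> (\<Sum>p\<in>?J. card (S w \<inter> cell r p))"
    by (rule card_UN_le) (simp add: finite_near_cells)
  also have "\<dots> = (\<Sum>p\<in>near_cells r. card (S w \<inter> cell r p) * indicator (avoids (cell_blockers R\<^sub>I r p)) w)"
    by (intro sum.mono_neutral_cong_left) (auto simp: finite_near_cells)
  finally show ?thesis by (simp add: degree_in_def)
qed

text \<open>\<open>l\<^sub>S / r ^ 2\<close> is the mean number of users in a cell,
  \<open>exp (4 * pi * l\<^sub>T)\<close> the price of shrinking the disks, and each of the two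
  equal factors bounds a geometric series in one coordinate.\<close>

lemma conditional_mean_degree_le:
  assumes l: "0 < l\<^sub>T" "0 < l\<^sub>S" and R: "0 < R\<^sub>p" "0 < R\<^sub>I" "R\<^sub>I + R\<^sub>p \<le> r"
    and r: "2 \<le> r" and rp: "rp \<le> r"
  shows "conditional_mean_degree M X D S R\<^sub>I r rp \<le>
    ennreal (l\<^sub>S * exp (4 * pi * l\<^sub>T) * (2 / (1 - exp (- (l\<^sub>T * pi / 8)))) ^ 2 / r ^ 2)"
proof -
  define E where "E = avoids (origin_blockers R\<^sub>I r)"
  define A where "A p = avoids (cell_blockers R\<^sub>I r p)" for p
  \<comment> \<open>The rate \<open>l\<^sub>T * pi / 4\<close> of the area estimate is halved on
    passing from the norm to the sum of the coordinates.\<close>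
  define \<theta> where "\<theta> = exp (- (l\<^sub>T * pi / 8))"
  define n where "n = nat \<lceil>r * r\<rceil> + 1"
  define c where "c = exp (4 * pi * l\<^sub>T)"
  have \<theta>: "0 < \<theta>" "\<theta> < 1" using l by (auto simp: \<theta>_def)
  have blockers: "cell_blockers R\<^sub>I r p \<in> sets (borel \<Otimes>\<^sub>M borel)" for p
    unfolding cell_blockers_def by (intro sets.Un sets_origin_blockers sets_pair_sum_in) auto
  have E [measurable]: "E \<in> events" unfolding E_def by (intro avoids_event sets_origin_blockers)
  have A [measurable]: "A p \<in> events" for p unfolding A_def by (intro avoids_event blockers)
  have E_pos: "prob E > 0" unfolding E_def by (rule prob_avoids_origin_blockers_pos) fact+
  have A_E: "A p \<subseteq> E" for p by (auto simp: A_def E_def avoids_def cell_blockers_def)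
  have cell: "cell r p \<in> sets borel" "bounded (cell r p)" for p by (auto simp: cell_def bounded_cbox)
  have [measurable]: "(\<lambda>w. card (S w \<inter> cell r p)) \<in> measurable M (count_space UNIV)" for p
    using secondary_poisson cell by (auto simp: homogeneous_poisson_process_def point_process_def)
  have prob_A: "prob (A p) \<le> prob E * (c * (\<theta> ^ nat \<bar>fst p\<bar> * \<theta> ^ nat \<bar>snd p\<bar>))" if "p \<in> near_cells r" for p
  proof -
    have \<theta>_power: "\<theta> ^ nat \<bar>i\<bar> = exp (- (l\<^sub>T * pi / 8) * \<bar>of_int i\<bar>)" for i
      unfolding \<theta>_def exp_of_nat_mult[symmetric] by (simp add: mult.commute)
    have "\<theta> ^ nat \<bar>fst p\<bar> * \<theta> ^ nat \<bar>snd p\<bar> = exp (- (l\<^sub>T * pi / 8) * (\<bar>of_int (fst p)\<bar> + \<bar>of_int (snd p)\<bar>))"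
      unfolding \<theta>_power distrib_left exp_add ..
    moreover have "l\<^sub>T * pi / 4 * ((\<bar>of_int (fst p)\<bar> + \<bar>of_int (snd p)\<bar>) / 2) \<le> l\<^sub>T * pi / 4 * (r * norm (cell_corner r p))"
      using l r by (intro mult_left_mono scaled_norm_cell_corner_ge) auto
    ultimately have "exp (4 * pi * l\<^sub>T - l\<^sub>T * pi / 4 * (r * norm (cell_corner r p))) \<le> c * (\<theta> ^ nat \<bar>fst p\<bar> * \<theta> ^ nat \<bar>snd p\<bar>)"
      unfolding c_def by (simp add: exp_add[symmetric])
    then have "prob E * exp (4 * pi * l\<^sub>T - l\<^sub>T * pi / 4 * (r * norm (cell_corner r p))) \<le>
        prob E * (c * (\<theta> ^ nat \<bar>fst p\<bar> * \<theta> ^ nat \<bar>snd p\<bar>))"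
      by (intro mult_left_mono) auto
    moreover have "prob (A p) \<le> prob E * exp (4 * pi * l\<^sub>T - l\<^sub>T * pi / 4 * (r * norm (cell_corner r p)))"
      unfolding A_def E_def cell_blockers_def using that
      by (intro prob_both_avoid_le l R r) (simp add: near_cells_def)
    ultimately show ?thesis by simp
  qed
  have "(\<integral>\<^sup>+w. of_nat (degree_in (transmitters X w) (receivers X D w) (insert 0 (S w)) R\<^sub>I r rp 0) \<partial>uniform_measure M E)
      \<le> (\<integral>\<^sup>+w. (\<Sum>p\<in>near_cells r. of_nat (card (S w \<inter> cell r p)) * indicator (A p) w) \<partial>uniform_measure M E)"
  proof (rule nn_integral_mono)
    fix w assume "w \<in> space (uniform_measure M E)"
    then have "degree_in (transmitters X w) (receivers X D w) (insert 0 (S w)) R\<^sub>I r rp 0 \<le>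
        (\<Sum>p\<in>near_cells r. card (S w \<inter> cell r p) * indicator (A p) w)"
      unfolding A_def by (intro degree_le_sum_cells r rp) simp
    then have "of_nat (degree_in (transmitters X w) (receivers X D w) (insert 0 (S w)) R\<^sub>I r rp 0) \<le>
        (of_nat (\<Sum>p\<in>near_cells r. card (S w \<inter> cell r p) * indicator (A p) w) :: ennreal)"
      by (rule of_nat_mono)
    also have "\<dots> = (\<Sum>p\<in>near_cells r. of_nat (card (S w \<inter> cell r p)) * indicator (A p) w)"
      by (auto simp: indicator_def intro!: sum.cong)
    finally show "of_nat (degree_in (transmitters X w) (receivers X D w) (insert 0 (S w)) R\<^sub>I r rp 0) \<le>
        (\<Sum>p\<in>near_cells r. of_nat (card (S w \<inter> cell r p)) * indicator (A p) w :: ennreal)" .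
  qed
  also have "\<dots> = (\<integral>\<^sup>+w. (\<Sum>p\<in>near_cells r. of_nat (card (S w \<inter> cell r p)) * indicator (A p) w) * indicator E w \<partial>M) / emeasure M E"
    by (rule nn_integral_uniform_measure) auto
  \<comment> \<open>Every \<open>A p\<close> lies in \<open>E\<close>, so the conditioning indicator
    is absorbed.\<close>
  also have "(\<integral>\<^sup>+w. (\<Sum>p\<in>near_cells r. of_nat (card (S w \<inter> cell r p)) * indicator (A p) w) * indicator E w \<partial>M) =
      (\<integral>\<^sup>+w. (\<Sum>p\<in>near_cells r. of_nat (card (S w \<inter> cell r p)) * indicator (A p) w) \<partial>M)"
    using A_E by (intro nn_integral_cong) (auto simp: indicator_def subset_eq intro!: sum.neutral)
  also have "\<dots> = (\<Sum>p\<in>near_cells r. \<integral>\<^sup>+w. of_nat (card (S w \<inter> cell r p)) * indicator (A p) w \<partial>M)"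
    by (rule nn_integral_sum) measurable
  also have "\<dots> = (\<Sum>p\<in>near_cells r. ennreal (l\<^sub>S * (1 / r ^ 2) * prob (A p)))"
  proof (rule sum.cong[OF refl])
    fix p
    show "(\<integral>\<^sup>+w. of_nat (card (S w \<inter> cell r p)) * indicator (A p) w \<partial>M) = ennreal (l\<^sub>S * (1 / r ^ 2) * prob (A p))"
      using nn_integral_poisson_count_indep[OF prob_space_axioms secondary_poisson cell
          secondary_indep_primary avoids_primary_event[OF blockers], of p] measure_cell[of r p] r
      by (simp add: A_def)
  qed
  also have "\<dots> / emeasure M E = ennreal ((\<Sum>p\<in>near_cells r. l\<^sub>S * (1 / r ^ 2) * prob (A p)) / prob E)"
    using E_pos l by (simp add: emeasure_eq_measure divide_ennreal sum_nonneg)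
  also have "\<dots> \<le> ennreal (l\<^sub>S * c * (2 / (1 - \<theta>)) ^ 2 / r ^ 2)"
  proof (rule ennreal_leI)
    have "(\<Sum>p\<in>near_cells r. l\<^sub>S * (1 / r ^ 2) * prob (A p)) \<le>
        (\<Sum>p\<in>near_cells r. l\<^sub>S * (1 / r ^ 2) * (prob E * (c * (\<theta> ^ nat \<bar>fst p\<bar> * \<theta> ^ nat \<bar>snd p\<bar>))))"
      using l prob_A by (intro sum_mono mult_left_mono) auto
    also have "\<dots> = l\<^sub>S * (1 / r ^ 2) * prob E * c * (\<Sum>p\<in>near_cells r. \<theta> ^ nat \<bar>fst p\<bar> * \<theta> ^ nat \<bar>snd p\<bar>)"
      by (simp add: sum_distrib_left mult.assoc)
    also have "\<dots> \<le> l\<^sub>S * (1 / r ^ 2) * prob E * c * (2 / (1 - \<theta>)) ^ 2"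
    proof (rule mult_left_mono)
      \<comment> \<open>Over the full square the double sum factors into two equal one-dimensional
        sums.\<close>
      have "(\<Sum>p\<in>near_cells r. \<theta> ^ nat \<bar>fst p\<bar> * \<theta> ^ nat \<bar>snd p\<bar>) \<le>
          (\<Sum>p\<in>{- int n..int n} \<times> {- int n..int n}. \<theta> ^ nat \<bar>fst p\<bar> * \<theta> ^ nat \<bar>snd p\<bar>)"
        using \<theta> by (intro sum_mono2) (auto simp: near_cells_def n_def)
      also have "\<dots> = (\<Sum>i = - int n..int n. \<theta> ^ nat \<bar>i\<bar>) ^ 2"
        by (simp add: power2_eq_square sum_product sum.cartesian_product case_prod_beta)
      also have "\<dots> \<le> (2 / (1 - \<theta>)) ^ 2"
        using \<theta> by (intro power_mono sum_int_power_abs_le sum_nonneg) auto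
      finally show "(\<Sum>p\<in>near_cells r. \<theta> ^ nat \<bar>fst p\<bar> * \<theta> ^ nat \<bar>snd p\<bar>) \<le> (2 / (1 - \<theta>)) ^ 2" .
    qed (use l in \<open>auto simp: c_def\<close>)
    finally have "(\<Sum>p\<in>near_cells r. l\<^sub>S * (1 / r ^ 2) * prob (A p)) / prob E \<le>
        (l\<^sub>S * (1 / r ^ 2) * prob E * c * (2 / (1 - \<theta>)) ^ 2) / prob E"
      using E_pos by (intro divide_right_mono) auto
    \<comment> \<open>The common factor \<open>prob E\<close> cancels against the normalisation of
      the conditional measure.\<close>
    also have "\<dots> = l\<^sub>S * c * (2 / (1 - \<theta>)) ^ 2 / r ^ 2"
      using E_pos by simp
    finally show "(\<Sum>p\<in>near_cells r. l\<^sub>S * (1 / r ^ 2) * prob (A p)) / prob E \<le> l\<^sub>S * c * (2 / (1 - \<theta>)) ^ 2 / r ^ 2" .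
  qed
  finally have "(\<integral>\<^sup>+w. of_nat (degree_in (transmitters X w) (receivers X D w) (insert 0 (S w)) R\<^sub>I r rp 0) \<partial>uniform_measure M E)
      \<le> ennreal (l\<^sub>S * c * (2 / (1 - \<theta>)) ^ 2 / r ^ 2)" .
  moreover have "{w \<in> space M. sees_opportunity (transmitters X w) (receivers X D w) R\<^sub>I r 0} = E"
    using sees_opportunity_origin_iff by (auto simp: E_def avoids_def)
  ultimately show ?thesis
    unfolding conditional_mean_degree_def c_def \<theta>_def by simp
qed

end


section \<open>Dependence on the transmission power\<close>

theorem corollary3:
  fixes M :: "'w measure"
    and X D :: "nat \<Rightarrow> 'w \<Rightarrow> real ^ 2"
    and S :: "'w \<Rightarrow> (real ^ 2) set"
    and l\<^sub>T l\<^sub>S R\<^sub>p R\<^sub>I c \<alpha> \<beta> :: real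
    and r\<^sub>I r\<^sub>p :: "real \<Rightarrow> real"
    and \<mu> :: "real \<Rightarrow> ennreal"
  assumes "l\<^sub>S > 0" and "l\<^sub>T > 0" and "R\<^sub>p > 0" and "R\<^sub>I > 0"
    and "c > 0" and "\<alpha> > 0" and "0 < \<beta>" and "\<beta> < 1"
    and "heterogeneous_network M l\<^sub>T l\<^sub>S R\<^sub>p X D S"
    and "\<And>p. p > 0 \<Longrightarrow> r\<^sub>I p = c * p powr (1 / \<alpha>)"
    and "\<And>p. p > 0 \<Longrightarrow> r\<^sub>p p = \<beta> * r\<^sub>I p"
    and "\<And>p. p > 0 \<Longrightarrow> \<mu> p = conditional_mean_degree M X D S R\<^sub>I (r\<^sub>I p) (r\<^sub>p p)"
  shows "\<exists>K>0. \<exists>p\<^sub>0>0. \<forall>p>p\<^sub>0. \<mu> p \<le> ennreal (K * \<bar>p powr (- 2 / \<alpha>)\<bar>)"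
proof -
  interpret heterogeneous_network M l\<^sub>T l\<^sub>S R\<^sub>p X D S by fact
  \<comment> \<open>The radius from which the degree bound holds;
    \<open>(L / c) powr \<alpha>\<close> is the power at which the interference radius equals
    \<open>L\<close>.\<close>
  define L where "L = max 2 (R\<^sub>I + R\<^sub>p)"
  define K where "K = l\<^sub>S * exp (4 * pi * l\<^sub>T) * (2 / (1 - exp (- (l\<^sub>T * pi / 8)))) ^ 2 / c ^ 2"
  note pos = assms(1-8)
  have "exp (- (l\<^sub>T * pi / 8)) \<noteq> 1" using pos by simp
  then have "K > 0"
    using pos by (simp add: K_def)
  moreover have "(L / c) powr \<alpha> > 0" using pos by (simp add: L_def)
  moreover have "\<mu> p \<le> ennreal (K * \<bar>p powr (- 2 / \<alpha>)\<bar>)" if p: "p > (L / c) powr \<alpha>" for p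
  proof -
    have "p > 0" using p by (rule le_less_trans[OF powr_ge_zero])
    have "L / c = ((L / c) powr \<alpha>) powr (1 / \<alpha>)"
      using pos by (simp add: powr_powr L_def)
    also have "\<dots> < p powr (1 / \<alpha>)"
      using p pos by (intro powr_less_mono2) auto
    finally have "L \<le> r\<^sub>I p"
      using pos assms(10)[OF \<open>p > 0\<close>] by (simp add: field_simps)
    then have r: "2 \<le> r\<^sub>I p" "R\<^sub>I + R\<^sub>p \<le> r\<^sub>I p" by (auto simp: L_def)
    \<comment> \<open>The ratio enters only through \<open>r\<^sub>p p \<le> r\<^sub>I p\<close>, so
      \<open>K\<close> does not depend on \<open>\<beta>\<close>.\<close>
    then have "\<beta> * r\<^sub>I p \<le> r\<^sub>I p" using pos by (intro mult_left_le_one_le) auto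
    then have "\<mu> p \<le> ennreal (l\<^sub>S * exp (4 * pi * l\<^sub>T) * (2 / (1 - exp (- (l\<^sub>T * pi / 8)))) ^ 2 / (r\<^sub>I p) ^ 2)"
      unfolding assms(12)[OF \<open>p > 0\<close>] assms(11)[OF \<open>p > 0\<close>]
      using pos r by (intro conditional_mean_degree_le)
    also have "(r\<^sub>I p) ^ 2 = c ^ 2 * p powr (2 / \<alpha>)"
    proof -
      have "(p powr (1 / \<alpha>)) ^ 2 = p powr (2 / \<alpha>)"
        using \<open>p > 0\<close> by (simp add: powr_power)
      then show ?thesis
        unfolding assms(10)[OF \<open>p > 0\<close>] power_mult_distrib by (rule arg_cong)
    qed
    also have "l\<^sub>S * exp (4 * pi * l\<^sub>T) * (2 / (1 - exp (- (l\<^sub>T * pi / 8)))) ^ 2 / (c ^ 2 * p powr (2 / \<alpha>)) =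
        K * \<bar>p powr (- 2 / \<alpha>)\<bar>"
    proof -
      have "\<bar>p powr (- 2 / \<alpha>)\<bar> = inverse (p powr (2 / \<alpha>))"
        unfolding powr_minus[symmetric] by simp
      then show ?thesis
        by (simp only: K_def divide_inverse inverse_mult_distrib mult.assoc)
    qed
    finally show ?thesis .
  qed
  ultimately show ?thesis by blast
qed

end
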